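(* Let $T>0$ and let $X$ be an $\mathbb{N}$-valued random variable with nonnegative density $f$ with respect to $\pi_T$. Then, for all $a\in[0,1]$, $$I(T_a(X)|\pi_{aT})\le a\,I(X|\pi_T).$$
   Context: $\mathbb{N}=\{0,1,2,\dots\}$. For $T>0$, $\pi_T(k)=e^{-T}T^k/k!$ is the Poisson measure on $\mathbb{N}$; $\pi_0$ is the point mass at $0$. "$X$ has density $f$ with respect to $\pi_T$" means $\mathbb{P}(X=k)=f(k)\pi_T(k)$ for all $k$. For $a\in[0,1]$ the $a$-thinning of $X$ is $T_a(X):=\sum_{i=1}^X B_i$, where $(B_i)_{i\ge1}$ are i.i.d. Bernoulli random variables with $\mathbb{P}(B_i=1)=a$, independent of $X$. Write $Dg(k)=g(k+1)-g(k)$. If $Y$ has density $g:\mathbb{N}\to[0,\infty)$ with respect to $\pi_t$, $t>0$, the Fisher information is $$I(Y|\pi_t):=t\sum_{k=0}^\infty\frac{(Dg(k))^2}{g(k)}\pi_t(k)\in[0,\infty],$$ with the conventions $\frac00=0$ and $\frac{x}{0}=+\infty$ for $x>0$. For $t=0$ (the trivial case $a=0$), $I(\cdot|\pi_0)=0$, and $0\cdot\infty=0$. *)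

theory Defs
  imports "HOL-Probability.Probability"
begin

text \<open>
  The library's \<^const>\<open>poisson_pmf\<close> is only specified for positive rates, so the point mass
  at rate 0 is a separate case.
\<close>

definition poisson_law :: "real \<Rightarrow> nat pmf" where
  "poisson_law t = (if t = 0 then return_pmf 0 else poisson_pmf t)"

lemma pmf_poisson_law:
  assumes "t > 0"
  shows "pmf (poisson_law t) k = exp (- t) * t ^ k / fact k"
  using assms by (simp add: poisson_law_def)

definition has_poisson_density :: "'a measure \<Rightarrow> ('a \<Rightarrow> nat) \<Rightarrow> (nat \<Rightarrow> real) \<Rightarrow> real \<Rightarrow> bool" where
  "has_poisson_density M Y g t \<longleftrightarrow>
     (\<forall>k. measure M {\<omega> \<in> space M. Y \<omega> = k} = g k * pmf (poisson_law t) k)"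

definition discrete_diff :: "(nat \<Rightarrow> real) \<Rightarrow> nat \<Rightarrow> real" where
  "discrete_diff g k = g (Suc k) - g k"

text \<open>
  Division in \<^typ>\<open>ennreal\<close> satisfies \<open>0 / 0 = 0\<close> and \<open>x / 0 = \<infinity>\<close> for \<open>x > 0\<close>, and
  multiplication satisfies \<open>0 * \<infinity> = 0\<close>; in particular the value at \<open>t = 0\<close> is 0.
  The function \<open>g\<close> is meant to be nonnegative.
\<close>

definition fisher_functional :: "(nat \<Rightarrow> real) \<Rightarrow> real \<Rightarrow> ennreal" where
  "fisher_functional g t =
     ennreal t * (\<Sum>k. ennreal ((discrete_diff g k)\<^sup>2) / ennreal (g k) * ennreal (pmf (poisson_law t) k))"

text \<open>
  For \<open>t > 0\<close> the Poisson law charges every point, so \<open>Y\<close> has exactly one density, namely the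
  quotient below; see \<open>poisson_density_unique\<close> and \<open>fisher_information_eq\<close>.
\<close>

definition poisson_density :: "'a measure \<Rightarrow> ('a \<Rightarrow> nat) \<Rightarrow> real \<Rightarrow> nat \<Rightarrow> real" where
  "poisson_density M Y t k = measure M {\<omega> \<in> space M. Y \<omega> = k} / pmf (poisson_law t) k"

definition fisher_information :: "'a measure \<Rightarrow> ('a \<Rightarrow> nat) \<Rightarrow> real \<Rightarrow> ennreal" where
  "fisher_information M Y t = fisher_functional (poisson_density M Y t) t"

lemma poisson_density_nonneg: "poisson_density M Y t k \<ge> 0"
  by (simp add: poisson_density_def)

lemma poisson_density_unique:
  assumes "t > 0"
  shows "has_poisson_density M Y g t \<longleftrightarrow> g = poisson_density M Y t"
proof -
  have "pmf (poisson_law t) k \<noteq> 0" for k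
    using assms by (simp add: pmf_poisson_law)
  then show ?thesis
    by (auto simp: has_poisson_density_def poisson_density_def fun_eq_iff divide_simps)
qed

lemma fisher_information_eq:
  assumes "t > 0" and "has_poisson_density M Y g t"
  shows "fisher_information M Y t = fisher_functional g t"
  using assms by (simp add: fisher_information_def poisson_density_unique)

lemma fisher_information_0: "fisher_information M Y 0 = 0"
  by (simp add: fisher_information_def fisher_functional_def)

text \<open>
  \<open>B 1, B 2, \<dots>\<close> are i.i.d. Bernoulli with parameter \<open>a\<close> (measurability is part of
  \<open>indep_vars\<close>), and the whole sequence is independent of \<open>X\<close>. Since \<open>indep_var\<close> only
  relates variables of the same type, the latter is expressed by the generated sigma-algebras.
\<close>

definition thinning_sequence ::
  "'a measure \<Rightarrow> ('a \<Rightarrow> nat) \<Rightarrow> real \<Rightarrow> (nat \<Rightarrow> 'a \<Rightarrow> nat) \<Rightarrow> bool" where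
  "thinning_sequence M X a B \<longleftrightarrow>
     prob_space.indep_vars M (\<lambda>_. count_space UNIV) B {1..} \<and>
     (\<forall>i\<in>{1..}. distr M (count_space UNIV) (B i) = measure_pmf (map_pmf of_bool (bernoulli_pmf a))) \<and>
     prob_space.indep_set M
       (sets (vimage_algebra (space M) X (count_space UNIV)))
       (sets (vimage_algebra (space M) (\<lambda>\<omega>. \<lambda>i\<in>{1..}. B i \<omega>) (\<Pi>\<^sub>M i\<in>{1..}. count_space UNIV)))"

definition thinning :: "(nat \<Rightarrow> 'a \<Rightarrow> nat) \<Rightarrow> ('a \<Rightarrow> nat) \<Rightarrow> 'a \<Rightarrow> nat" where
  "thinning B X \<omega> = (\<Sum>i=1..X \<omega>. B i \<omega>)"

end

theory Submission
  imports Defs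
begin

text \<open>
  Splitting \<open>\<pi>\<^sub>T\<close> into two independent Poisson laws of rates \<open>aT\<close> and \<open>(1 - a)T\<close> shows that the
  density of the thinning is \<open>g(j) = (\<Sum>m. f(j + m) \<pi>\<^bsub>(1-a)T\<^esub>(m))\<close>. This averaging commutes with
  the difference operator, so the Cauchy--Schwarz inequality (joint convexity of \<open>(x, y) \<mapsto> x\<^sup>2 / y\<close>)
  bounds \<open>(Dg)\<^sup>2 / g\<close> by the same average of \<open>(Df)\<^sup>2 / f\<close>. Integrating against \<open>\<pi>\<^bsub>aT\<^esub>\<close> recombines
  the two Poisson laws into \<open>\<pi>\<^sub>T\<close>; the factor \<open>a\<close> comes from the prefactor \<open>aT\<close>.
\<close>

section \<open>Rearrangement of double series of extended nonnegative reals\<close>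

lemma ennreal_suminf_swap:
  fixes F :: "nat \<Rightarrow> nat \<Rightarrow> ennreal"
  shows "(\<Sum>j. \<Sum>n. F j n) = (\<Sum>n. \<Sum>j. F j n)"
proof -
  have "(\<Sum>j. \<Sum>n. F j n) = (\<integral>\<^sup>+j. (\<Sum>n. F j n) \<partial>count_space UNIV)"
    by (simp add: nn_integral_count_space_nat)
  also have "\<dots> = (\<Sum>n. \<integral>\<^sup>+j. F j n \<partial>count_space UNIV)"
    by (rule nn_integral_suminf) simp
  finally show ?thesis
    by (simp add: nn_integral_count_space_nat)
qed

text \<open>Moving the shift into a condition on the summand turns a triangular double series into a
  rectangular one, to which the exchange of sums applies.\<close>

lemma ennreal_suminf_shift:
  fixes F :: "nat \<Rightarrow> ennreal"
  shows "(\<Sum>m. F (j + m)) = (\<Sum>n. if j \<le> n then F n else 0)"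
  by (subst suminf_offset[where i = j]) (auto simp: add.commute)

text \<open>Pairs \<open>(j, m)\<close> are regrouped along the diagonals \<open>n = j + m\<close>.
  Infinite values of \<open>h\<close> are allowed, as needed when it is a Fisher integrand.\<close>

lemma ennreal_suminf_convolution:
  fixes h p q :: "nat \<Rightarrow> ennreal"
  shows "(\<Sum>j. (\<Sum>m. h (j + m) * p m) * q j) = (\<Sum>n. h n * (\<Sum>j\<le>n. q j * p (n - j)))"
proof -
  have "(\<Sum>m. h (j + m) * p m) * q j = (\<Sum>n. if j \<le> n then h n * p (n - j) * q j else 0)" for j
    using ennreal_suminf_shift[of "\<lambda>n. h n * p (n - j) * q j" j] by simp
  moreover have "(\<Sum>j. if j \<le> n then h n * p (n - j) * q j else 0)
      = h n * (\<Sum>j\<le>n. q j * p (n - j))" for n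
    by (subst suminf_finite[of "{..n}"]) (auto simp: sum_distrib_left mult_ac)
  ultimately show ?thesis
    using ennreal_suminf_swap[of "\<lambda>j n. if j \<le> n then h n * p (n - j) * q j else 0"] by simp
qed

section \<open>Splitting and recombining Poisson laws\<close>

lemma pmf_poisson_law_nonneg_rate:
  assumes "t \<ge> 0"
  shows "pmf (poisson_law t) k = exp (- t) * t ^ k / fact k"
  \<comment> \<open>At rate 0 the convention \<open>0 ^ 0 = 1\<close> yields the point mass; this
    rate occurs as \<open>(1 - a) * T\<close> when \<open>a = 1\<close>.\<close>
  using assms by (cases "t = 0") (auto simp: poisson_law_def power_0_left indicator_def)

text \<open>If each of Poisson many points is kept with probability \<open>a\<close>, the numbers of
  kept and lost points are independent Poisson variables: the factorial of \<open>j + m\<close>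
  cancels against the binomial coefficient.\<close>

lemma poisson_law_splitting:
  assumes "T > 0" "0 \<le> a" "a \<le> 1"
  shows "pmf (poisson_law T) (j + m) * (real ((j + m) choose j) * a ^ j * (1 - a) ^ m)
    = pmf (poisson_law (a * T)) j * pmf (poisson_law ((1 - a) * T)) m"
proof -
  have "exp (- T) = exp (- (a * T)) * exp (- ((1 - a) * T))"
    by (simp add: exp_add[symmetric] algebra_simps)
  moreover have "real ((j + m) choose j) = fact (j + m) / (fact j * fact m)"
    by (simp add: binomial_fact)
  ultimately show ?thesis
    using assms by (simp add: pmf_poisson_law_nonneg_rate power_mult_distrib power_add)
qed

lemma poisson_law_convolution:
  assumes "T > 0" "0 \<le> a" "a \<le> 1"
  shows "(\<Sum>j\<le>n. pmf (poisson_law (a * T)) j * pmf (poisson_law ((1 - a) * T)) (n - j))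
    = pmf (poisson_law T) n"
proof -
  have "(\<Sum>j\<le>n. pmf (poisson_law (a * T)) j * pmf (poisson_law ((1 - a) * T)) (n - j))
    = (\<Sum>j\<le>n. pmf (poisson_law T) n * (real (n choose j) * a ^ j * (1 - a) ^ (n - j)))"
  proof (rule sum.cong)
    fix j assume "j \<in> {..n}"
    then show "pmf (poisson_law (a * T)) j * pmf (poisson_law ((1 - a) * T)) (n - j)
      = pmf (poisson_law T) n * (real (n choose j) * a ^ j * (1 - a) ^ (n - j))"
      using poisson_law_splitting[OF assms, of j "n - j"] by simp
  qed simp
  also have "\<dots> = pmf (poisson_law T) n * (a + (1 - a)) ^ n"
    unfolding binomial_ring by (simp add: sum_distrib_left)
  finally show ?thesis
    by simp
qed

section \<open>A Cauchy--Schwarz inequality for quotients\<close>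

text \<open>
  The proof integrates the tangent bound \<open>d\<^sup>2 / f \<ge> 2 \<lambda> d - \<lambda>\<^sup>2 f\<close>, optimal at \<open>\<lambda> = D / G\<close>;
  a vanishing \<open>G\<close> needs arbitrarily large \<open>\<lambda>\<close>.
\<close>

lemma cauchy_schwarz_quotient:
  fixes f d q :: "nat \<Rightarrow> real"
  assumes f: "\<And>m. f m \<ge> 0" and q: "\<And>m. q m \<ge> 0"
    and G: "(\<lambda>m. f m * q m) sums G" and D: "(\<lambda>m. d m * q m) sums D"
  shows "ennreal (D\<^sup>2) / ennreal G \<le> (\<Sum>m. ennreal ((d m)\<^sup>2) / ennreal (f m) * ennreal (q m))"
    (is "_ \<le> ?R")
proof (cases "?R = \<top>")
  case False
  have fin: "ennreal ((d m)\<^sup>2) / ennreal (f m) * ennreal (q m) \<noteq> \<top>" for m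
    using ennreal_suminf_lessD[OF False[unfolded less_top], of m] by (simp only: less_top)
  \<comment> \<open>A nonzero numerator over \<open>f m = 0\<close> with positive weight would
    contribute an infinite term.\<close>
  have zero: "d m = 0 \<or> q m = 0" if "f m = 0" for m
    using fin[of m] that q[of m]
    by (auto simp: divide_ennreal_def ennreal_mult_top ennreal_top_mult split: if_splits)
  define r where "r m = (d m)\<^sup>2 / f m * q m" for m
  have r_nonneg: "r m \<ge> 0" for m
    using f q by (simp add: r_def)
  \<comment> \<open>By \<open>zero\<close>, real division, with \<open>x / 0 = 0\<close>, agrees
    here with the extended one once the weight is included.\<close>
  have r: "ennreal ((d m)\<^sup>2) / ennreal (f m) * ennreal (q m) = ennreal (r m)" for m
  proof (cases "f m = 0")
    case True
    then show ?thesis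
      using zero[of m] by (auto simp: r_def)
  next
    case False
    then show ?thesis
      using f[of m] q[of m] by (simp add: r_def divide_ennreal ennreal_mult[symmetric])
  qed
  have sr: "summable r"
    by (rule summable_suminf_not_top) (use False r_nonneg in \<open>simp_all add: r\<close>)
  have R: "?R = ennreal (suminf r)"
    using r_nonneg sr by (simp add: r suminf_ennreal2)
  have tangent: "2 * l * D - l\<^sup>2 * G \<le> suminf r" for l
  proof (rule sums_le)
    show "(\<lambda>m. 2 * l * (d m * q m) - l\<^sup>2 * (f m * q m)) sums (2 * l * D - l\<^sup>2 * G)"
      by (intro sums_diff sums_mult D G)
    show "r sums suminf r"
      using sr by (rule summable_sums)
    show "2 * l * (d m * q m) - l\<^sup>2 * (f m * q m) \<le> r m" for m
    proof (cases "f m = 0")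
      case True
      then show ?thesis
        using zero[of m] by (auto simp: r_def)
    next
      case False
      then have pos: "f m > 0"
        using f[of m] by simp
      \<comment> \<open>The gap in the tangent bound is a complete square divided by
        \<open>f m\<close>.\<close>
      have "0 \<le> (d m - l * f m)\<^sup>2 / f m * q m"
        using pos q[of m] by simp
      also have "\<dots> = r m - (2 * l * (d m * q m) - l\<^sup>2 * (f m * q m))"
        using pos by (simp add: r_def field_simps power2_eq_square)
      finally show ?thesis
        by simp
    qed
  qed
  have "G \<ge> 0"
    using f q G by (intro sums_le[OF _ sums_zero G]) simp
  show ?thesis
  proof (cases "G = 0")
    case True
    have "D = 0"
    proof (rule ccontr)
      assume "D \<noteq> 0"
      then show False
        \<comment> \<open>With \<open>G = 0\<close> this slope makes the left side of
          \<open>tangent\<close> equal to \<open>suminf r + 1\<close>.\<close>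
        using tangent[of "(suminf r + 1) / (2 * D)"] True by simp
    qed
    then show ?thesis
      by simp
  next
    case False
    with \<open>G \<ge> 0\<close> have "G > 0"
      by simp
    then have "D\<^sup>2 / G \<le> suminf r"
      using tangent[of "D / G"] by (simp add: field_simps power2_eq_square)
    then show ?thesis
      using \<open>G > 0\<close> by (simp add: R divide_ennreal ennreal_leI)
  qed
qed simp

section \<open>The law and the density of the thinning\<close>

context prob_space
begin

text \<open>Induction on \<open>n\<close>: splitting by the value of the last variable, which is
  independent of the partial sum, reproduces Pascal's rule.\<close>

lemma prob_sum_bernoulli:
  fixes B :: "nat \<Rightarrow> 'a \<Rightarrow> nat"
  assumes indep: "indep_vars (\<lambda>_. count_space UNIV) B {1..}"
    and distr: "\<And>i. i \<ge> 1 \<Longrightarrow>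
      distr M (count_space UNIV) (B i) = measure_pmf (map_pmf of_bool (bernoulli_pmf a))"
    and a: "0 \<le> a" "a \<le> 1"
  shows "prob {\<omega> \<in> space M. (\<Sum>i=1..n. B i \<omega>) = j} = real (n choose j) * a ^ j * (1 - a) ^ (n - j)"
proof (induction n arbitrary: j)
  case 0
  show ?case
    by (cases j) (simp_all add: prob_space)
next
  case (Suc n)
  have meas: "B i \<in> measurable M (count_space UNIV)" if "i \<ge> 1" for i
    using indep that by (auto simp: indep_vars_def)
  have measS: "(\<lambda>\<omega>. \<Sum>i=1..n. B i \<omega>) \<in> measurable M (count_space UNIV)"
    using meas by measurable
  have point: "prob {\<omega> \<in> space M. B (Suc n) \<omega> = k} = pmf (map_pmf of_bool (bernoulli_pmf a)) k" for k
  proof -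
    have "measure (distr M (count_space UNIV) (B (Suc n))) {k} = prob {\<omega> \<in> space M. B (Suc n) \<omega> = k}"
      using meas[of "Suc n"] by (subst measure_distr) (auto intro!: arg_cong[where f = prob])
    then show ?thesis
      by (simp add: distr measure_pmf_single)
  qed
  have b1: "prob {\<omega> \<in> space M. B (Suc n) \<omega> = 1} = a"
   and b0: "prob {\<omega> \<in> space M. B (Suc n) \<omega> = 0} = 1 - a"
    using a unfolding point by (simp_all add: map_pmf_def pmf_bind)
  \<comment> \<open>The index sets \<open>{Suc n}\<close> and \<open>{1..n}\<close> are disjoint, so
    functions of the two restricted families are independent.\<close>
  have "indep_var (count_space UNIV) ((\<lambda>x. x (Suc n)) \<circ> (\<lambda>\<omega>. \<lambda>i\<in>{Suc n}. B i \<omega>))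
      (count_space UNIV) ((\<lambda>x. \<Sum>i=1..n. x i) \<circ> (\<lambda>\<omega>. \<lambda>i\<in>{1..n}. B i \<omega>))"
    by (rule indep_var_compose[OF indep_var_restrict[OF indep]]) auto
  also have "(\<lambda>x. x (Suc n)) \<circ> (\<lambda>\<omega>. \<lambda>i\<in>{Suc n}. B i \<omega>) = B (Suc n)"
    by auto
  also have "(\<lambda>x. \<Sum>i=1..n. x i) \<circ> (\<lambda>\<omega>. \<lambda>i\<in>{1..n}. B i \<omega>) = (\<lambda>\<omega>. \<Sum>i=1..n. B i \<omega>)"
    by (auto simp: fun_eq_iff)
  finally have ind: "indep_var (count_space UNIV) (B (Suc n)) (count_space UNIV) (\<lambda>\<omega>. \<Sum>i=1..n. B i \<omega>)" .
  have prod: "prob {\<omega> \<in> space M. B (Suc n) \<omega> = k \<and> (\<Sum>i=1..n. B i \<omega>) = l}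
      = prob {\<omega> \<in> space M. B (Suc n) \<omega> = k} * prob {\<omega> \<in> space M. (\<Sum>i=1..n. B i \<omega>) = l}" for k l
    using indep_varD[OF ind, of "{k}" "{l}"] by (simp add: vimage_def Int_def conj_commute)
  let ?S = "\<lambda>\<omega>. \<Sum>i=1..n. B i \<omega>"
  have sets: "{\<omega> \<in> space M. B (Suc n) \<omega> = k \<and> ?S \<omega> = l} \<in> sets M" for k l
    using meas[of "Suc n"] measS by measurable
  \<comment> \<open>The law of \<open>B (Suc n)\<close> forces values 0 and 1 only up to a null set,
    so the case split below for positive \<open>j\<close> is an almost sure one.\<close>
  have "AE k in distr M (count_space UNIV) (B (Suc n)). k = 0 \<or> k = 1"
    by (subst distr) (auto simp: AE_measure_pmf_iff)
  then have ae: "AE \<omega> in M. B (Suc n) \<omega> = 0 \<or> B (Suc n) \<omega> = 1"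
    by (rule AE_distrD[OF meas[of "Suc n", simplified]])
  have measT: "(\<lambda>\<omega>. \<Sum>i=1..Suc n. B i \<omega>) \<in> measurable M (count_space UNIV)"
    using meas by measurable
  have setT: "{\<omega> \<in> space M. (\<Sum>i=1..Suc n. B i \<omega>) = j} \<in> sets M"
    using measT by measurable
  show ?case
  proof (cases j)
    case 0
    have "prob {\<omega> \<in> space M. (\<Sum>i=1..Suc n. B i \<omega>) = j} = prob {\<omega> \<in> space M. B (Suc n) \<omega> = 0 \<and> ?S \<omega> = 0}"
      by (rule arg_cong[where f = prob]) (auto simp: 0)
    also have "\<dots> = (1 - a) * (1 - a) ^ n"
      unfolding prod b0 Suc.IH by simp
    finally show ?thesis
      by (simp add: 0)
  next
    case (Suc i)
    have "prob {\<omega> \<in> space M. (\<Sum>i=1..Suc n. B i \<omega>) = j}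
      = prob ({\<omega> \<in> space M. B (Suc n) \<omega> = 0 \<and> ?S \<omega> = j} \<union> {\<omega> \<in> space M. B (Suc n) \<omega> = 1 \<and> ?S \<omega> = i})"
      by (rule finite_measure_eq_AE) (use ae setT sets in \<open>auto simp: Suc elim!: eventually_mono\<close>)
    also have "\<dots> = (1 - a) * prob {\<omega> \<in> space M. ?S \<omega> = j} + a * prob {\<omega> \<in> space M. ?S \<omega> = i}"
      by (subst finite_measure_Union) (auto simp: sets prod b0 b1 simp del: One_nat_def)
    also have "\<dots> = real (Suc n choose j) * a ^ j * (1 - a) ^ (Suc n - j)"
    \<comment> \<open>For \<open>j > n\<close> the subtraction \<open>n - j\<close> is truncated,
      but its term carries the coefficient \<open>n choose j = 0\<close>.\<close>
    proof (cases "j \<le> n")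
      case True
      then have "Suc n - j = Suc (n - j)" "n - i = Suc (n - j)"
        using Suc by auto
      then show ?thesis
        unfolding Suc.IH by (simp add: Suc algebra_simps)
    next
      case False
      then show ?thesis
        unfolding Suc.IH by (simp add: Suc binomial_eq_0)
    qed
    finally show ?thesis .
  qed
qed

text \<open>Given \<open>X = n\<close>, the thinning is binomial with parameters \<open>n\<close>
  and \<open>a\<close>; the law of total probability is then written with
  \<open>n = j + m\<close>.\<close>

lemma prob_thinning:
  fixes X :: "'a \<Rightarrow> nat" and B :: "nat \<Rightarrow> 'a \<Rightarrow> nat"
  assumes X: "X \<in> measurable M (count_space UNIV)"
    and B: "thinning_sequence M X a B" and a: "0 \<le> a" "a \<le> 1"
  shows "(\<lambda>m. prob {\<omega> \<in> space M. X \<omega> = j + m} * (real ((j + m) choose j) * a ^ j * (1 - a) ^ m))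
    sums prob {\<omega> \<in> space M. thinning B X \<omega> = j}"
proof -
  let ?S = "\<lambda>n \<omega>. \<Sum>i=1..n. B i \<omega>"
  have indep: "indep_vars (\<lambda>_. count_space UNIV) B {1..}"
    and distr: "\<And>i. i \<ge> 1 \<Longrightarrow>
      distr M (count_space UNIV) (B i) = measure_pmf (map_pmf of_bool (bernoulli_pmf a))"
    and set: "indep_set (sets (vimage_algebra (space M) X (count_space UNIV)))
       (sets (vimage_algebra (space M) (\<lambda>\<omega>. \<lambda>i\<in>{1..}. B i \<omega>) (\<Pi>\<^sub>M i\<in>{1..}. count_space UNIV)))"
    using B by (auto simp: thinning_sequence_def)
  have meas: "B i \<in> measurable M (count_space UNIV)" if "i \<ge> 1" for i
    using indep that by (auto simp: indep_vars_def)
  have measS: "?S n \<in> measurable M (count_space UNIV)" for n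
    using meas by measurable
  \<comment> \<open>On \<open>X = n\<close> the sum of random length becomes one of fixed
    length.\<close>
  define E where "E n = {\<omega> \<in> space M. X \<omega> = n \<and> ?S n \<omega> = j}" for n
  have "E n \<in> sets M" for n
    unfolding E_def using X measS[of n] by measurable
  then have "range E \<subseteq> sets M"
    by auto
  moreover have "disjoint_family E"
    by (auto simp: E_def disjoint_family_on_def)
  ultimately have "(\<lambda>n. prob (E n)) sums prob (\<Union>n. E n)"
    by (rule finite_measure_UNION)
  moreover have "(\<Union>n. E n) = {\<omega> \<in> space M. thinning B X \<omega> = j}"
    by (auto simp: E_def thinning_def)
  moreover have E: "prob (E n)
      = prob {\<omega> \<in> space M. X \<omega> = n} * (real (n choose j) * a ^ j * (1 - a) ^ (n - j))" for n
  proof -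
    have 1: "{\<omega> \<in> space M. X \<omega> = n} \<in> sets (vimage_algebra (space M) X (count_space UNIV))"
      using in_vimage_algebra[of "{n}" "count_space UNIV" X "space M"]
      by (simp add: vimage_def Int_def conj_commute)
    \<comment> \<open>The fixed-length sum is a measurable function of the whole sequence, so its
      event lies in the sigma-algebra assumed independent of \<open>X\<close>.\<close>
    have "(\<lambda>x. \<Sum>i=1..n. x i) \<in> measurable (\<Pi>\<^sub>M i\<in>{1..}. count_space UNIV) (count_space (UNIV :: nat set))"
      by measurable
    from measurable_sets[OF this, of "{j}"]
    have "(\<lambda>\<omega>. \<lambda>i\<in>{1..}. B i \<omega>) -`
        ((\<lambda>x. \<Sum>i=1..n. x i) -` {j} \<inter> space (\<Pi>\<^sub>M i\<in>{1..}. count_space UNIV)) \<inter> space M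
      \<in> sets (vimage_algebra (space M) (\<lambda>\<omega>. \<lambda>i\<in>{1..}. B i \<omega>) (\<Pi>\<^sub>M i\<in>{1..}. count_space UNIV))"
      by (intro in_vimage_algebra) auto
    also have "(\<lambda>\<omega>. \<lambda>i\<in>{1..}. B i \<omega>) -`
        ((\<lambda>x. \<Sum>i=1..n. x i) -` {j} \<inter> space (\<Pi>\<^sub>M i\<in>{1..}. count_space UNIV)) \<inter> space M
      = {\<omega> \<in> space M. ?S n \<omega> = j}"
      by (auto simp: space_PiM)
    finally have 2: "{\<omega> \<in> space M. ?S n \<omega> = j}
      \<in> sets (vimage_algebra (space M) (\<lambda>\<omega>. \<lambda>i\<in>{1..}. B i \<omega>) (\<Pi>\<^sub>M i\<in>{1..}. count_space UNIV))" .
    have "E n = {\<omega> \<in> space M. X \<omega> = n} \<inter> {\<omega> \<in> space M. ?S n \<omega> = j}"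
      by (auto simp: E_def)
    then show ?thesis
      using indep_setD[OF set 1 2] prob_sum_bernoulli[OF indep distr a] by simp
  qed
  ultimately have "(\<lambda>n. prob (E n)) sums prob {\<omega> \<in> space M. thinning B X \<omega> = j}"
    by simp
  \<comment> \<open>Fewer than \<open>j\<close> trials cannot give \<open>j\<close> successes, so
    the series may start at \<open>n = j\<close>.\<close>
  moreover have "(\<Sum>n<j. prob (E n)) = 0"
    by (simp add: E binomial_eq_0)
  ultimately have "(\<lambda>m. prob (E (m + j))) sums prob {\<omega> \<in> space M. thinning B X \<omega> = j}"
    using sums_iff_shift[of "\<lambda>n. prob (E n)" j] by simp
  then show ?thesis
    by (simp add: E add.commute)
qed

text \<open>By \<open>poisson_law_splitting\<close> every term of the law of the thinning contains
  the factor \<open>pmf (poisson_law (a * T)) j\<close>, which is positive as \<open>a > 0\<close>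
  and can be divided out.\<close>

lemma poisson_density_thinning:
  fixes X :: "'a \<Rightarrow> nat" and B :: "nat \<Rightarrow> 'a \<Rightarrow> nat"
  assumes T: "T > 0" and X: "X \<in> measurable M (count_space UNIV)"
    and f: "has_poisson_density M X f T"
    and B: "thinning_sequence M X a B" and a: "0 < a" "a \<le> 1"
  shows "(\<lambda>m. f (j + m) * pmf (poisson_law ((1 - a) * T)) m)
    sums poisson_density M (thinning B X) (a * T) j"
proof -
  have "a * T > 0"
    using a T by simp
  then have nz: "pmf (poisson_law (a * T)) j \<noteq> 0"
    using a T by (simp add: pmf_poisson_law)
  have "prob {\<omega> \<in> space M. X \<omega> = j + m} * (real ((j + m) choose j) * a ^ j * (1 - a) ^ m)
      = f (j + m) * pmf (poisson_law ((1 - a) * T)) m * pmf (poisson_law (a * T)) j" for m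
    using f poisson_law_splitting[OF T, of a j m] a
    by (simp add: has_poisson_density_def mult.assoc)
  then show ?thesis
    using sums_divide[OF prob_thinning[OF X B, of j], of "pmf (poisson_law (a * T)) j"] a nz
    by (simp add: poisson_density_def)
qed

end

section \<open>Contraction of the Fisher information\<close>

theorem theorem1p4:
  fixes M :: "'a measure" and X :: "'a \<Rightarrow> nat" and f :: "nat \<Rightarrow> real"
    and B :: "nat \<Rightarrow> 'a \<Rightarrow> nat" and T a :: real
  assumes "T > 0"
    and "prob_space M"
    and "X \<in> measurable M (count_space UNIV)"
    and "\<And>k. f k \<ge> 0"
    and "has_poisson_density M X f T"
    and "a \<in> {0..1}"
    and "thinning_sequence M X a B"
  shows "fisher_information M (thinning B X) (a * T) \<le> ennreal a * fisher_information M X T"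
proof (cases "a = 0")
  case True
  then show ?thesis
    by (simp add: fisher_information_0)
next
  case False
  with assms have a: "0 < a" "a \<le> 1"
    by auto
  define g where "g = poisson_density M (thinning B X) (a * T)"
  define p where "p = pmf (poisson_law ((1 - a) * T))"
  define q where "q = pmf (poisson_law (a * T))"
  define h where "h k = ennreal ((discrete_diff f k)\<^sup>2) / ennreal (f k)" for k
  have g: "(\<lambda>m. f (j + m) * p m) sums g j" for j
    unfolding g_def p_def
    using assms a by (intro prob_space.poisson_density_thinning)
  \<comment> \<open>Subtracting the series for \<open>j\<close> from that for \<open>Suc j\<close>
    term by term moves the difference onto \<open>f\<close>.\<close>
  have Dg: "(\<lambda>m. discrete_diff f (j + m) * p m) sums discrete_diff g j" for j
    using sums_diff[OF g[of "Suc j"] g[of j]] by (simp add: discrete_diff_def algebra_simps)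
  \<comment> \<open>For fixed \<open>j\<close>, the quotient bound is applied to the shifted
    sequence \<open>f (j + m)\<close> with weights \<open>p m\<close>.\<close>
  have "ennreal ((discrete_diff g j)\<^sup>2) / ennreal (g j) \<le> (\<Sum>m. h (j + m) * ennreal (p m))" for j
    unfolding h_def using assms(4)
    by (intro cauchy_schwarz_quotient g Dg) (simp_all add: p_def)
  then have "(\<Sum>j. ennreal ((discrete_diff g j)\<^sup>2) / ennreal (g j) * ennreal (q j))
      \<le> (\<Sum>j. (\<Sum>m. h (j + m) * ennreal (p m)) * ennreal (q j))"
    by (intro suminf_le mult_right_mono) auto
  also have "\<dots> = (\<Sum>n. h n * (\<Sum>j\<le>n. ennreal (q j) * ennreal (p (n - j))))"
    by (rule ennreal_suminf_convolution)
  \<comment> \<open>The weights along each diagonal form the convolution of the laws of rates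
    \<open>a * T\<close> and \<open>(1 - a) * T\<close>.\<close>
  also have "\<dots> = (\<Sum>n. h n * ennreal (pmf (poisson_law T) n))"
    using poisson_law_convolution[of T a] assms(1) a
    by (simp add: p_def q_def ennreal_mult[symmetric] sum_ennreal)
  finally have "ennreal (a * T) * (\<Sum>j. ennreal ((discrete_diff g j)\<^sup>2) / ennreal (g j) * ennreal (q j))
      \<le> ennreal (a * T) * (\<Sum>n. h n * ennreal (pmf (poisson_law T) n))"
    by (rule mult_left_mono) simp
  moreover have "fisher_information M (thinning B X) (a * T)
      = ennreal (a * T) * (\<Sum>j. ennreal ((discrete_diff g j)\<^sup>2) / ennreal (g j) * ennreal (q j))"
    by (simp add: fisher_information_def fisher_functional_def g_def q_def)
  moreover have "ennreal a * fisher_information M X T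
      = ennreal (a * T) * (\<Sum>n. h n * ennreal (pmf (poisson_law T) n))"
    using fisher_information_eq[OF assms(1,5)] a assms(1)
    by (simp add: fisher_functional_def h_def ennreal_mult mult.assoc)
  ultimately show ?thesis
    by simp
qed

end
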